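(* Let $G$ be a Polish group, let $X$ be a Polish space, and let $m$ be a continuous topological partial action of $G$ on $X$ such that $G*X$ is a $G_\delta$ subset of $G\times X$. If the orbit equivalence relation $E^p_G$ on $X$ is smooth, then it has a Borel selector.
   Context: A partial action of a group $G$ (identity $1$) on a set $X$ is a partially defined map $m: G\times X\to X$, $(g,x)\mapsto g\cdot x$, such that, writing $\exists g\cdot x$ to mean that $(g,x)$ is in the domain of $m$, for all $g,h\in G$ and $x\in X$: (PA1) if $\exists g\cdot x$ then $\exists g^{-1}\cdot(g\cdot x)$ and $g^{-1}\cdot(g\cdot x)=x$; (PA2) if $\exists g\cdot(h\cdot x)$ then $\exists (gh)\cdot x$ and $g\cdot(h\cdot x)=(gh)\cdot x$; (PA3) $\exists 1\cdot x$ and $1\cdot x=x$. Notation: $G*X=\{(g,x)\in G\times X:\exists g\cdot x\}$ (with the subspace topology from $G\times X$); $X_{g^{-1}}=\{x\in X:\exists g\cdot x\}$; $m_g: X_{g^{-1}}\to X_g$, $x\mapsto g\cdot x$ (a bijection). For $G$ a topological group and $X$ a topological space, the partial action is topological if each $X_g$ is open in $X$ and each $m_g$ is a homeomorphism; it is continuous if $m: G*X\to X$ is continuous. Orbit equivalence relation: $x\,E^p_G\,y$ iff there is $g\in G$ with $\exists g\cdot x$ and $g\cdot x=y$. An equivalence relation $E$ on $X$ is smooth if there are a Polish space $Y$ and a Borel map $f: X\to Y$ such that $xEy$ iff $f(x)=f(y)$. A Borel selector for $E$ is a Borel function $S: X\to X$ such that $xEy$ iff $S(x)=S(y)$, and $S(x)Ex$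 for all $x\in X$. A Polish space is a separable completely metrizable space; a Polish group is a topological group whose topology is Polish. *)

theory Defs
  imports "HOL-Analysis.Analysis" "HOL-Algebra.Group"
begin

section \<open>Polish spaces, Polish groups and Borel maps\<close>

text \<open>
  The library class \<open>polish_space\<close> carries a fixed metric and has a whole type as its
  underlying set; here spaces are topologies on an arbitrary carrier set.
\<close>

definition Polish_topology :: "'a topology \<Rightarrow> bool" where
  "Polish_topology X \<longleftrightarrow> separable_space X \<and> completely_metrizable_space X"

definition Borel_algebra :: "'a topology \<Rightarrow> 'a measure" where
  "Borel_algebra X = sigma (topspace X) {U. openin X U}"

abbreviation Borel_map :: "'a topology \<Rightarrow> 'b topology \<Rightarrow> ('a \<Rightarrow> 'b) \<Rightarrow> bool" where
  "Borel_map X Y f \<equiv> f \<in> measurable (Borel_algebra X) (Borel_algebra Y)"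

locale topological_group = group G for G :: "('g, 'r) monoid_scheme" (structure) +
  fixes T :: "'g topology"
  assumes topspace_eq_carrier: "topspace T = carrier G"
    and continuous_mult: "continuous_map (prod_topology T T) T (\<lambda>(g, h). g \<otimes> h)"
    and continuous_inv: "continuous_map T T (\<lambda>g. inv g)"

locale Polish_group = topological_group +
  assumes Polish: "Polish_topology T"


section \<open>Partial actions\<close>

text \<open>
  A partially defined map \<open>m\<close> from \<open>G \<times> X\<close> to \<open>X\<close> is an option-valued function that is
  \<open>None\<close> outside \<open>G \<times> X\<close>; \<open>m g x = Some y\<close> says that \<open>g \<cdot> x\<close> exists and equals \<open>y\<close>.
\<close>

locale partial_action = group G for G :: "('g, 'r) monoid_scheme" (structure) +
  fixes X :: "'x set" and m :: "'g \<Rightarrow> 'x \<Rightarrow> 'x option"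
  assumes typing: "m g x = Some y \<Longrightarrow> g \<in> carrier G \<and> x \<in> X \<and> y \<in> X"
    and PA1: "m g x = Some y \<Longrightarrow> m (inv g) y = Some x"
    and PA2: "m h x = Some y \<Longrightarrow> m g y = Some z \<Longrightarrow> m (g \<otimes> h) x = Some z"
    and PA3: "x \<in> X \<Longrightarrow> m \<one> x = Some x"

definition action_domain :: "('g \<Rightarrow> 'x \<Rightarrow> 'x option) \<Rightarrow> ('g \<times> 'x) set" where
  "action_domain m = {(g, x). m g x \<noteq> None}"

text \<open>The set \<open>X\<^sub>g\<close> of those \<open>x\<close> for which \<open>g\<^sup>-\<^sup>1 \<cdot> x\<close> exists.\<close>

definition pa_range ::
  "('g, 'r) monoid_scheme \<Rightarrow> ('g \<Rightarrow> 'x \<Rightarrow> 'x option) \<Rightarrow> 'g \<Rightarrow> 'x set" where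
  "pa_range G m g = dom (m (inv\<^bsub>G\<^esub> g))"

locale topological_partial_action =
  topological_group G T + partial_action G "topspace X" m
  for G :: "('g, 'r) monoid_scheme" (structure) and T :: "'g topology"
    and X :: "'x topology" and m :: "'g \<Rightarrow> 'x \<Rightarrow> 'x option" +
  assumes open_range: "g \<in> carrier G \<Longrightarrow> openin X (pa_range G m g)"
    and homeo: "g \<in> carrier G \<Longrightarrow>
      homeomorphic_map (subtopology X (pa_range G m (inv g))) (subtopology X (pa_range G m g))
        (\<lambda>x. the (m g x))"

locale continuous_topological_partial_action = topological_partial_action +
  assumes continuous_action:
    "continuous_map (subtopology (prod_topology T X) (action_domain m)) X (\<lambda>(g, x). the (m g x))"

definition orbit_rel ::
  "('g, 'r) monoid_scheme \<Rightarrow> ('g \<Rightarrow> 'x \<Rightarrow> 'x option) \<Rightarrow> ('x \<times> 'x) set" where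
  "orbit_rel G m = {(x, y). \<exists>g \<in> carrier G. m g x = Some y}"

lemma (in partial_action) equiv_orbit_rel: "equiv X (orbit_rel G m)"
proof (rule equivI)
  show "orbit_rel G m \<subseteq> X \<times> X"
    using typing by (auto simp: orbit_rel_def)
  show "refl_on X (orbit_rel G m)"
    using PA3 by (auto simp: orbit_rel_def refl_on_def)
  show "sym (orbit_rel G m)"
    using PA1 by (fastforce simp: orbit_rel_def sym_def)
  show "trans (orbit_rel G m)"
    using PA2 by (fastforce simp: orbit_rel_def trans_def)
qed


section \<open>Smoothness and Borel selectors\<close>

text \<open>
  HOL cannot quantify over the type of the points of \<open>Y\<close> inside a formula, so that type is a
  parameter. A theorem that assumes smoothness with a free type variable \<open>'y\<close> holds for
  Polish spaces \<open>Y\<close> over every type.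
\<close>

definition smooth_rel :: "'y itself \<Rightarrow> 'x topology \<Rightarrow> ('x \<times> 'x) set \<Rightarrow> bool" where
  "smooth_rel (_ :: 'y itself) X E \<longleftrightarrow>
     (\<exists>(Y :: 'y topology) f. Polish_topology Y \<and> Borel_map X Y f \<and>
        (\<forall>x \<in> topspace X. \<forall>y \<in> topspace X. (x, y) \<in> E \<longleftrightarrow> f x = f y))"

definition Borel_selector :: "'x topology \<Rightarrow> ('x \<times> 'x) set \<Rightarrow> ('x \<Rightarrow> 'x) \<Rightarrow> bool" where
  "Borel_selector X E S \<longleftrightarrow> Borel_map X X S \<and>
     (\<forall>x \<in> topspace X. \<forall>y \<in> topspace X. (x, y) \<in> E \<longleftrightarrow> S x = S y) \<and>
     (\<forall>x \<in> topspace X. (S x, x) \<in> E)"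

end

theory Submission
  imports Defs
begin

text \<open>
  For a point \<open>x\<close> the set \<open>D x\<close> of all \<open>g\<close> such that \<open>g \<cdot> x\<close> exists is a \<open>G\<^sub>\<delta>\<close> subset of
  \<open>G\<close>, hence a Baire space, and right translation by \<open>h\<^sup>-\<^sup>1\<close> maps \<open>D x\<close> homeomorphically onto
  \<open>D (h \<cdot> x)\<close>. So ``\<open>g \<cdot> x \<in> A\<close> for nonmeagerly many \<open>g \<in> D x\<close>'' is an invariant property of
  \<open>x\<close>, and as for global actions it is Borel when \<open>A\<close> is. Let \<open>f\<close> witness smoothness. There is a
  Borel code \<open>h\<close> of points of \<open>X\<close> by sequences of natural numbers such that, whenever the codes
  of a sequence \<open>u\<close> in \<open>X\<close> converge, \<open>u\<close> converges to some \<open>z\<close> and \<open>f \<circ> u\<close> converges to \<open>f z\<close>. For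
  each \<open>x\<close> follow the leftmost branch of codes along which \<open>g \<cdot> x\<close> stays for nonmeagerly many
  \<open>g\<close>. It is the limit of the codes of points of the orbit of \<open>x\<close>, so these points converge to some
  \<open>S x\<close> with \<open>f (S x) = f x\<close>, that is, to a point of the orbit. The branch depends on \<open>x\<close> in an
  invariant and Borel way, and it determines \<open>S x\<close>.
\<close>

section \<open>Topological preliminaries\<close>

lemma gdelta_in_continuous_map_preimage:
  assumes f: "continuous_map X Y f" and S: "gdelta_in Y S"
  shows "gdelta_in X {x \<in> topspace X. f x \<in> S}"
proof -
  obtain C where C: "\<And>n::nat. openin Y (C n)" "\<And>n. C (Suc n) \<subseteq> C n" "\<Inter> (range C) = S"
    using S by (auto simp: gdelta_in_descending)
  have "openin X {x \<in> topspace X. f x \<in> C n}" for n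
    using openin_continuous_map_preimage[OF f C(1)] .
  moreover have "{x \<in> topspace X. f x \<in> C (Suc n)} \<subseteq> {x \<in> topspace X. f x \<in> C n}" for n
    using C(2) by blast
  moreover have "\<Inter> (range (\<lambda>n. {x \<in> topspace X. f x \<in> C n})) = {x \<in> topspace X. f x \<in> S}"
    using C(3) by auto
  ultimately show ?thesis
    unfolding gdelta_in_descending by (intro exI[of _ "\<lambda>n. {x \<in> topspace X. f x \<in> C n}"]) auto
qed

lemma (in Metric_space) dense_ball_cover:
  assumes "mtopology closure_of C = M" "x \<in> M" "0 < e"
  obtains q where "q \<in> C" "q \<in> M" "d q x < e"
proof -
  have "x \<in> mtopology closure_of C"
    using assms by simp
  then show ?thesis
    using that assms(3) by (fastforce simp: metric_closure_of in_mball commute)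
qed

lemma (in Metric_space) separable_imp_second_countable:
  assumes "separable_space mtopology"
  shows "second_countable mtopology"
proof -
  obtain C where C: "countable C" "C \<subseteq> M" "mtopology closure_of C = M"
    using assms by (auto simp: separable_space_def)
  define B where "B = (\<lambda>(q, n::nat). mball q (1 / Suc n)) ` (C \<times> UNIV)"
  have "\<exists>V\<in>B. x \<in> V \<and> V \<subseteq> U" if U: "openin mtopology U" "x \<in> U" for U x
  proof -
    obtain r where r: "r > 0" "mball x r \<subseteq> U"
      using U by (auto simp: openin_mtopology)
    have x: "x \<in> M"
      using U openin_subset by fastforce
    obtain n where "1 / real (Suc n) < r / 2"
      using nat_approx_posE[of "r / 2"] r(1) by auto
    then have n: "2 / real (Suc n) < r"
      by (simp add: field_simps)
    obtain q where q: "q \<in> C" "q \<in> M" "d q x < 1 / Suc n"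
      using dense_ball_cover[OF C(3) x, of "1 / Suc n"] by auto
    have "mball q (1 / Suc n) \<subseteq> mball x r"
    proof
      fix y assume y: "y \<in> mball q (1 / Suc n)"
      then have "d x y \<le> d q x + d q y"
        using triangle[of x q y] x q by (simp add: commute)
      also have "\<dots> < 2 / Suc n"
        using q(3) y by simp
      finally show "y \<in> mball x r"
        using x y n by simp
    qed
    then show ?thesis
      using q r x unfolding B_def by (intro bexI[of _ "mball q (1 / Suc n)"]) auto
  qed
  moreover have "countable B" "\<forall>V\<in>B. openin mtopology V"
    using C by (auto simp: B_def)
  ultimately show ?thesis
    unfolding second_countable_def by blast
qed

lemma Polish_topology_countable_base:
  assumes "Polish_topology X"
  obtains \<B> where "countable \<B>" "\<forall>V\<in>\<B>. openin X V"
    "\<forall>U x. openin X U \<and> x \<in> U \<longrightarrow> (\<exists>V\<in>\<B>. x \<in> V \<and> V \<subseteq> U)"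
proof -
  have "second_countable X"
    using assms Metric_space.separable_imp_second_countable
    unfolding Polish_topology_def completely_metrizable_space_def by blast
  then show ?thesis
    using that unfolding second_countable_def by (elim exE conjE)
qed

section \<open>Baire category\<close>

text \<open>Closed sets with empty interior stand in for arbitrary nowhere dense sets, which is the
  form that \<open>Baire_category_alt\<close> takes.\<close>

definition meager_in :: "'a topology \<Rightarrow> 'a set \<Rightarrow> bool" where
  "meager_in X A \<longleftrightarrow>
    (\<exists>\<G>. countable \<G> \<and> (\<forall>C\<in>\<G>. closedin X C \<and> X interior_of C = {}) \<and> A \<subseteq> \<Union>\<G>)"

lemma meager_in_subset: "meager_in X B \<Longrightarrow> A \<subseteq> B \<Longrightarrow> meager_in X A"
  unfolding meager_in_def by (meson order_trans)

lemma meager_in_empty [simp]: "meager_in X {}"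
  unfolding meager_in_def by (intro exI[of _ "{}"]) simp

lemma meager_in_UN:
  assumes "countable I" "\<And>i. i \<in> I \<Longrightarrow> meager_in X (A i)"
  shows "meager_in X (\<Union>i\<in>I. A i)"
proof -
  obtain \<G> where "\<And>i. i \<in> I \<Longrightarrow> countable (\<G> i) \<and>
      (\<forall>C\<in>\<G> i. closedin X C \<and> X interior_of C = {}) \<and> A i \<subseteq> \<Union>(\<G> i)"
    using assms(2) unfolding meager_in_def by metis
  with assms(1) show ?thesis
    unfolding meager_in_def by (intro exI[of _ "\<Union>i\<in>I. \<G> i"]) fastforce
qed

lemma meager_in_Un:
  assumes "meager_in X A" "meager_in X B"
  shows "meager_in X (A \<union> B)"
  using meager_in_UN[of "{A, B}" X "\<lambda>S. S"] assms by auto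

text \<open>An open set inside the frontier misses \<open>U\<close>, hence also misses the closure
  of \<open>U\<close>, and so is empty.\<close>

lemma meager_in_frontier_of_openin:
  assumes "openin X U"
  shows "meager_in X (X frontier_of U)"
proof -
  let ?W = "X interior_of (X frontier_of U)"
  have "?W \<subseteq> X closure_of U - U"
    using interior_of_subset[of X "X frontier_of U"] assms frontier_of_openin by metis
  moreover have "?W \<inter> U = {} \<longleftrightarrow> ?W \<inter> X closure_of U = {}"
    by (simp add: openin_Int_closure_of_eq_empty)
  ultimately have "?W = {}"
    by blast
  then show ?thesis
    unfolding meager_in_def using closedin_frontier_of
    by (intro exI[of _ "{X frontier_of U}"]) auto
qed

lemma not_meager_in_openin:
  assumes "completely_metrizable_space X" "openin X U" "U \<noteq> {}"
  shows "\<not> meager_in X U"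
proof
  assume "meager_in X U"
  then obtain \<G> where \<G>: "countable \<G>" "\<And>C. C \<in> \<G> \<Longrightarrow> closedin X C \<and> X interior_of C = {}"
      "U \<subseteq> \<Union>\<G>"
    unfolding meager_in_def by blast
  then have "X interior_of \<Union>\<G> = {}"
    using Baire_category_alt assms(1) by blast
  with \<G>(3) assms(2,3) show False
    using interior_of_maximal by blast
qed

lemma meager_in_homeomorphic_image:
  assumes f: "homeomorphic_map X Y f" and A: "meager_in X A"
  shows "meager_in Y (f ` A)"
proof -
  obtain \<G> where \<G>: "countable \<G>" "\<And>C. C \<in> \<G> \<Longrightarrow> closedin X C \<and> X interior_of C = {}"
      "A \<subseteq> \<Union>\<G>"
    using A unfolding meager_in_def by blast
  have "closedin Y (f ` C) \<and> Y interior_of (f ` C) = {}" if "C \<in> \<G>" for C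
  proof -
    have "C \<subseteq> topspace X"
      using \<G>(2) that closedin_subset by blast
    then show ?thesis
      using \<G>(2)[OF that] f homeomorphic_map_closedness homeomorphic_map_interior_of by fastforce
  qed
  with \<G> show ?thesis
    unfolding meager_in_def by (intro exI[of _ "(`) f ` \<G>"]) (auto 0 4 simp: subset_iff)
qed

section \<open>Sets with the Baire property\<close>

definition Baire_property :: "'a topology \<Rightarrow> 'a set \<Rightarrow> bool" where
  "Baire_property X A \<longleftrightarrow> (\<exists>U. openin X U \<and> meager_in X ((A - U) \<union> (U - A)))"

lemma Baire_property_openin: "openin X U \<Longrightarrow> Baire_property X U"
  unfolding Baire_property_def by (intro exI[of _ U]) simp

text \<open>Pass from \<open>U\<close> to the complement of its closure: the error grows only by the
  frontier of \<open>U\<close>, which is meager.\<close>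

lemma Baire_property_complement:
  assumes "Baire_property X A"
  shows "Baire_property X (topspace X - A)"
proof -
  obtain U where U: "openin X U" "meager_in X ((A - U) \<union> (U - A))"
    using assms unfolding Baire_property_def by blast
  define V where "V = topspace X - X closure_of U"
  have "openin X V"
    by (simp add: V_def openin_diff)
  moreover have "((topspace X - A) - V) \<union> (V - (topspace X - A))
      \<subseteq> ((A - U) \<union> (U - A)) \<union> X frontier_of U"
    using U(1) closure_of_subset[of U X] openin_subset[OF U(1)]
    by (auto simp: V_def frontier_of_def interior_of_openin)
  then have "meager_in X (((topspace X - A) - V) \<union> (V - (topspace X - A)))"
    using meager_in_subset meager_in_Un[OF U(2) meager_in_frontier_of_openin[OF U(1)]] by blast
  ultimately show ?thesis
    unfolding Baire_property_def by blast
qed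

lemma Baire_property_UN:
  assumes "countable I" "\<And>i. i \<in> I \<Longrightarrow> Baire_property X (A i)"
  shows "Baire_property X (\<Union>i\<in>I. A i)"
proof -
  obtain U where U: "\<And>i. i \<in> I \<Longrightarrow> openin X (U i)"
      "\<And>i. i \<in> I \<Longrightarrow> meager_in X ((A i - U i) \<union> (U i - A i))"
    using assms(2) unfolding Baire_property_def by metis
  have "meager_in X (\<Union>i\<in>I. (A i - U i) \<union> (U i - A i))"
    using meager_in_UN[OF assms(1) U(2)] .
  then have "meager_in X (((\<Union>i\<in>I. A i) - (\<Union>i\<in>I. U i)) \<union> ((\<Union>i\<in>I. U i) - (\<Union>i\<in>I. A i)))"
    by (rule meager_in_subset) blast
  with U(1) show ?thesis
    unfolding Baire_property_def by (intro exI[of _ "\<Union>i\<in>I. U i"]) auto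
qed

text \<open>If \<open>A\<close> agrees with an open \<open>W\<close> up to a meager set, then
  \<open>U\<close> minus the closure of \<open>W\<close> serves as \<open>V\<close>. This trades a
  statement about the complement of \<open>A\<close> for one about \<open>A\<close> on smaller open
  sets, as the complement case of \<open>transform_in_Borel\<close> requires.\<close>

lemma not_meager_in_diff_iff:
  assumes X: "completely_metrizable_space X" and A: "Baire_property X A" and U: "openin X U"
  shows "\<not> meager_in X (U - A) \<longleftrightarrow> (\<exists>V. openin X V \<and> V \<noteq> {} \<and> V \<subseteq> U \<and> meager_in X (V \<inter> A))"
    (is "?L \<longleftrightarrow> ?R")
proof
  assume ?R
  then obtain V where V: "openin X V" "V \<noteq> {}" "V \<subseteq> U" "meager_in X (V \<inter> A)"
    by blast
  have "meager_in X V" if "meager_in X (U - A)"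
    using meager_in_subset[OF meager_in_Un[OF that V(4)], of V] V(3) by blast
  with V X show ?L
    using not_meager_in_openin by blast
next
  assume L: ?L
  obtain W where W: "openin X W" "meager_in X ((A - W) \<union> (W - A))"
    using A unfolding Baire_property_def by blast
  define V where "V = U - X closure_of W"
  have "V \<inter> A \<subseteq> (A - W) \<union> (W - A)"
    using closure_of_subset[of W X] openin_subset[OF W(1)] by (auto simp: V_def)
  then have m: "meager_in X (V \<inter> A)"
    using W(2) meager_in_subset by blast
  have "V \<noteq> {}"
  proof
    assume "V = {}"
    then have "U - A \<subseteq> ((A - W) \<union> (W - A)) \<union> X frontier_of W"
      using W(1) by (auto simp: V_def frontier_of_def interior_of_openin)
    then show False
      using L meager_in_subset meager_in_Un[OF W(2) meager_in_frontier_of_openin[OF W(1)]] by blast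
  qed
  moreover have "openin X V"
    using U by (simp add: V_def openin_diff)
  ultimately show ?R
    using m unfolding V_def by blast
qed

section \<open>Coding points by sequences of natural numbers\<close>

lemma space_Borel_algebra [simp]: "space (Borel_algebra X) = topspace X"
  by (auto simp: Borel_algebra_def space_measure_of_conv)

lemma sets_Borel_algebra:
  "sets (Borel_algebra X) = sigma_sets (topspace X) {U. openin X U}"
  unfolding Borel_algebra_def by (rule sets_measure_of) (auto dest: openin_subset)

lemma openin_imp_Borel: "openin X U \<Longrightarrow> U \<in> sets (Borel_algebra X)"
  by (simp add: sets_Borel_algebra sigma_sets.Basic)

lemma closedin_imp_Borel:
  assumes "closedin X C"
  shows "C \<in> sets (Borel_algebra X)"
proof -
  have "topspace X - C \<in> sets (Borel_algebra X)"
    using assms openin_imp_Borel by blast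
  from sets.compl_sets[OF this] show ?thesis
    using closedin_subset[OF assms] by (simp add: double_diff)
qed

text \<open>The shift by one reserves the value 0 for points outside all \<open>C n\<close>, so the
  index decides membership in the union and otherwise names a set containing the point.\<close>

definition least_index :: "(nat \<Rightarrow> 'a set) \<Rightarrow> 'a \<Rightarrow> nat" where
  "least_index C x = (if x \<in> (\<Union>n. C n) then Suc (LEAST n. x \<in> C n) else 0)"

lemma least_index_eq_0: "least_index C x = 0 \<longleftrightarrow> x \<notin> (\<Union>n. C n)"
  by (simp add: least_index_def)

lemma least_index_eq_Suc: "least_index C x = Suc n \<Longrightarrow> x \<in> C n"
  by (auto simp: least_index_def split: if_splits intro: LeastI)

lemma measurable_least_index:
  assumes [measurable]: "\<And>n. C n \<in> sets M"
  shows "least_index C \<in> measurable M (count_space UNIV)"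
  unfolding least_index_def by measurable

text \<open>Convergence of the codes of \<open>u\<close> in Baire space, with the limit left
  unnamed.\<close>

definition settles :: "(nat \<Rightarrow> 'a \<Rightarrow> nat) \<Rightarrow> (nat \<Rightarrow> 'a) \<Rightarrow> bool" where
  "settles h u \<longleftrightarrow> (\<forall>n. \<exists>c. \<forall>\<^sub>F k in sequentially. h n (u k) = c)"

text \<open>Countably many codes become one through the pairing bijection, so that settling of the
  result gives settling of each.\<close>

definition merge :: "(nat \<Rightarrow> nat \<Rightarrow> 'a \<Rightarrow> nat) \<Rightarrow> nat \<Rightarrow> 'a \<Rightarrow> nat" where
  "merge H n = H (fst (prod_decode n)) (snd (prod_decode n))"

lemma merge_prod_encode [simp]: "merge H (prod_encode (i, j)) = H i j"
  by (simp add: merge_def)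

lemma settles_merge: "settles (merge H) u \<Longrightarrow> settles (H i) u"
  unfolding settles_def by (metis merge_prod_encode)

text \<open>A code \<open>h\<close> that controls \<open>A\<close> replaces a finer Polish topology in which \<open>A\<close> is clopen.\<close>

definition controls :: "'a topology \<Rightarrow> (nat \<Rightarrow> 'a \<Rightarrow> nat) \<Rightarrow> 'a set \<Rightarrow> bool" where
  "controls X h A \<longleftrightarrow> (\<forall>u z. range u \<subseteq> topspace X \<longrightarrow> limitin X u z sequentially \<longrightarrow>
     settles h u \<longrightarrow> (\<forall>\<^sub>F k in sequentially. u k \<in> A \<longleftrightarrow> z \<in> A))"

text \<open>Induction over the generation of \<open>A\<close>. An open set is a countable union of
  closed sets, and its code is the index of the first of them containing the point: a closed set
  keeps the limit of a sequence that stays in it.\<close>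

lemma Borel_controlled:
  assumes X: "metrizable_space X" and A: "A \<in> sets (Borel_algebra X)"
  obtains h where "\<And>n. h n \<in> measurable (Borel_algebra X) (count_space UNIV)" "controls X h A"
proof -
  have "A \<in> sigma_sets (topspace X) {U. openin X U}"
    using A by (simp add: sets_Borel_algebra)
  then have "\<exists>h. (\<forall>n. h n \<in> measurable (Borel_algebra X) (count_space UNIV)) \<and> controls X h A"
  proof induction
    case (Basic U)
    then have U: "openin X U"
      by simp
    then obtain C where C: "\<And>n. closedin X (C n)" "(\<Union>n::nat. C n) = U"
      using open_imp_fsigma_in[OF X] by (auto simp: fsigma_in_ascending)
    have "controls X (\<lambda>_. least_index C) U"
      unfolding controls_def
    proof (intro allI impI)
      fix u z
      assume u: "range u \<subseteq> topspace X" "limitin X u z sequentially"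
        "settles (\<lambda>_. least_index C) u"
      then obtain c where c: "\<forall>\<^sub>F k in sequentially. least_index C (u k) = c"
        unfolding settles_def by blast
      show "\<forall>\<^sub>F k in sequentially. u k \<in> U \<longleftrightarrow> z \<in> U"
      proof (cases c)
        case 0
        with c have *: "\<forall>\<^sub>F k in sequentially. u k \<notin> U"
          by (simp add: least_index_eq_0 C(2)[symmetric])
        have "z \<notin> U"
        proof
          assume "z \<in> U"
          then have "\<forall>\<^sub>F k in sequentially. u k \<in> U"
            using u(2) U by (simp add: limitin_def)
          with * have "\<forall>\<^sub>F k in sequentially. False"
            by eventually_elim blast
          then show False
            by simp
        qed
        with * show ?thesis
          by (auto elim: eventually_mono)
      next
        case (Suc n)
        with c have *: "\<forall>\<^sub>F k in sequentially. u k \<in> C n"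
          by (auto elim!: eventually_mono dest: least_index_eq_Suc)
        then have "z \<in> C n"
          using limitin_closedin[OF u(2) C(1) *] by simp
        with * show ?thesis
          using C(2) by (auto elim!: eventually_mono)
      qed
    qed
    moreover have "least_index C \<in> measurable (Borel_algebra X) (count_space UNIV)"
      using C(1) by (intro measurable_least_index closedin_imp_Borel)
    ultimately show ?case
      by (intro exI[of _ "\<lambda>_. least_index C"]) simp
  next
    case Empty
    show ?case
      by (intro exI[of _ "\<lambda>_ _. 0"]) (simp add: controls_def)
  next
    case (Compl A)
    then obtain h where h: "\<And>n. h n \<in> measurable (Borel_algebra X) (count_space UNIV)" "controls X h A"
      by blast
    have "controls X h (topspace X - A)"
      unfolding controls_def
    proof (intro allI impI)
      fix u z
      assume u: "range u \<subseteq> topspace X" "limitin X u z sequentially" "settles h u"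
      then have "\<forall>\<^sub>F k in sequentially. u k \<in> A \<longleftrightarrow> z \<in> A"
        using h(2) unfolding controls_def by blast
      moreover have "z \<in> topspace X" "\<And>k. u k \<in> topspace X"
        using u by (auto simp: limitin_def)
      ultimately show "\<forall>\<^sub>F k in sequentially. u k \<in> topspace X - A \<longleftrightarrow> z \<in> topspace X - A"
        by simp
    qed
    with h(1) show ?case
      by blast
  next
    case (Union A)
    then obtain H where H: "\<And>i n. H i n \<in> measurable (Borel_algebra X) (count_space UNIV)"
        "\<And>i. controls X (H i) (A i)"
      by metis
    \<comment> \<open>The codes \<open>H i\<close> give eventual agreement for each \<open>i\<close>
      separately, not uniformly in \<open>i\<close>. Coordinate 0 singles out one \<open>A n\<close>
      in which the sequence eventually stays, or excludes all of them.\<close>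
    define h where "h = case_nat (least_index A) (merge H)"
    have "A i \<in> sets (Borel_algebra X)" for i
      using Union by (simp add: sets_Borel_algebra)
    then have "h n \<in> measurable (Borel_algebra X) (count_space UNIV)" for n
      using H(1) measurable_least_index[of A "Borel_algebra X"]
      by (auto simp: h_def merge_def split: nat.split)
    moreover have "controls X h (\<Union>i. A i)"
      unfolding controls_def
    proof (intro allI impI)
      fix u z
      assume u: "range u \<subseteq> topspace X" "limitin X u z sequentially" "settles h u"
      have "settles (merge H) u"
        unfolding settles_def
      proof
        fix n
        show "\<exists>c. \<forall>\<^sub>F k in sequentially. merge H n (u k) = c"
          using u(3)[unfolded settles_def, rule_format, of "Suc n"] by (simp add: h_def)
      qed
      then have ev: "\<forall>\<^sub>F k in sequentially. u k \<in> A i \<longleftrightarrow> z \<in> A i" for i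
        using H(2)[of i] u settles_merge unfolding controls_def by blast
      obtain c where c: "\<forall>\<^sub>F k in sequentially. least_index A (u k) = c"
        using u(3)[unfolded settles_def, rule_format, of 0] by (auto simp: h_def)
      show "\<forall>\<^sub>F k in sequentially. u k \<in> (\<Union>i. A i) \<longleftrightarrow> z \<in> (\<Union>i. A i)"
      proof (cases c)
        case 0
        with c have *: "\<forall>\<^sub>F k in sequentially. u k \<notin> (\<Union>i. A i)"
          by (simp add: least_index_eq_0)
        have "z \<notin> A i" for i
        proof
          assume "z \<in> A i"
          then have "\<forall>\<^sub>F k in sequentially. u k \<in> A i"
            using ev[of i] by simp
          with * have "\<forall>\<^sub>F k in sequentially. False"
            by eventually_elim blast
          then show False
            by simp
        qed
        with * show ?thesis
          by (auto elim: eventually_mono)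
      next
        case (Suc n)
        with c have *: "\<forall>\<^sub>F k in sequentially. u k \<in> A n"
          by (auto elim!: eventually_mono dest: least_index_eq_Suc)
        with ev[of n] have "\<forall>\<^sub>F k in sequentially. z \<in> A n"
          by eventually_elim blast
        then have "z \<in> A n"
          by simp
        with * show ?thesis
          by (auto elim!: eventually_mono)
      qed
    qed
    ultimately show ?case
      by blast
  qed
  with that show ?thesis
    by blast
qed

text \<open>The coordinates at \<open>p j\<close> name a dense point within 1/(j+1) of the coded
  point. When they settle, the sequence is Cauchy, and completeness yields the limit that
  \<open>controls\<close> presupposes. They also allow the limit to be recovered from the
  code.\<close>

lemma (in Metric_space) complete_Borel_code:
  assumes complete: mcomplete
    and q: "range q \<subseteq> M" "mtopology closure_of (range q) = M"
    and A: "\<And>n::nat. A n \<in> sets (Borel_algebra mtopology)"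
  obtains h :: "nat \<Rightarrow> 'a \<Rightarrow> nat" and p :: "nat \<Rightarrow> nat"
  where "\<forall>n. h n \<in> measurable (Borel_algebra mtopology) (count_space UNIV)"
    and "\<forall>j. \<forall>x\<in>M. d (q (h (p j) x)) x < 1 / Suc j"
    and "\<forall>u. range u \<subseteq> M \<and> settles h u \<longrightarrow>
      (\<exists>z. limitin mtopology u z sequentially \<and>
        (\<forall>n. \<forall>\<^sub>F k in sequentially. u k \<in> A n \<longleftrightarrow> z \<in> A n))"
proof -
  have "metrizable_space mtopology"
    by (simp add: metrizable_space_mtopology)
  then have "\<exists>h. (\<forall>n. h n \<in> measurable (Borel_algebra mtopology) (count_space UNIV)) \<and>
      controls mtopology h (A i)" for i
    using Borel_controlled[OF _ A] by metis
  then obtain H where H: "\<And>i n. H i n \<in> measurable (Borel_algebra mtopology) (count_space UNIV)"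
      "\<And>i. controls mtopology (H i) (A i)"
    by metis
  define B where "B j n = mball (q n) (1 / Suc j)" for j n
  \<comment> \<open>Subtracting 1 undoes the shift in \<open>least_index\<close>; the index 0 does
    not occur on \<open>M\<close>, because the balls around a dense sequence cover it.\<close>
  define h0 where "h0 j x = least_index (B j) x - 1" for j x
  \<comment> \<open>\<open>h0\<close> is family 0 and \<open>H n\<close> is family
    \<open>Suc n\<close>, whence the positions \<open>prod_encode (0, j)\<close> in
    \<open>p\<close>.\<close>
  define h where "h = merge (case_nat h0 H)"
  define p where "p j = prod_encode (0, j)" for j
  have "least_index (B j) \<in> measurable (Borel_algebra mtopology) (count_space UNIV)" for j
    by (intro measurable_least_index openin_imp_Borel) (simp add: B_def)
  then have "h0 j \<in> measurable (Borel_algebra mtopology) (count_space UNIV)" for j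
    unfolding h0_def by measurable
  then have "h n \<in> measurable (Borel_algebra mtopology) (count_space UNIV)" for n
    using H(1) by (auto simp: h_def merge_def split: nat.split)
  moreover have near: "d (q (h (p j) x)) x < 1 / Suc j" if x: "x \<in> M" for j x
  proof -
    obtain n where "d (q n) x < 1 / Suc j"
      using dense_ball_cover[OF q(2) x, of "1 / Suc j"] by auto
    then have "x \<in> B j n"
      using q(1) x by (auto simp: B_def)
    then obtain n' where "least_index (B j) x = Suc n'"
      using least_index_eq_0[of "B j" x] by (cases "least_index (B j) x") auto
    then have "x \<in> B j (h (p j) x)"
      using least_index_eq_Suc by (simp add: h_def p_def h0_def)
    then show ?thesis
      by (simp add: B_def)
  qed
  moreover have "\<exists>z. limitin mtopology u z sequentially \<and>
        (\<forall>n. \<forall>\<^sub>F k in sequentially. u k \<in> A n \<longleftrightarrow> z \<in> A n)"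
    if u: "range u \<subseteq> M" and s: "settles h u" for u
  proof -
    have "MCauchy u"
      unfolding MCauchy_def
    proof (intro conjI allI impI)
      fix e :: real assume "0 < e"
      then obtain j where "1 / real (Suc j) < e / 2"
        using nat_approx_posE[of "e / 2"] by auto
      then have j: "2 / real (Suc j) < e"
        by (simp add: field_simps)
      obtain c K where K: "\<And>k. k \<ge> K \<Longrightarrow> h (p j) (u k) = c"
        using s unfolding settles_def eventually_sequentially by metis
      have "d (u k) (u k') < e" if "K \<le> k" "K \<le> k'" for k k'
      proof -
        have "d (u k) (u k') \<le> d (q c) (u k) + d (q c) (u k')"
          using triangle[of "u k" "q c" "u k'"] u q(1) by (simp add: commute range_subsetD)
        also have "\<dots> < 1 / Suc j + 1 / Suc j"
          using near[of "u k" j] near[of "u k'" j] K[OF that(1)] K[OF that(2)] u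
          by (intro add_strict_mono) auto
        finally show ?thesis
          using j by simp
      qed
      then show "\<exists>N. \<forall>n n'. N \<le> n \<longrightarrow> N \<le> n' \<longrightarrow> d (u n) (u n') < e"
        by blast
    qed (use u in auto)
    then obtain z where z: "limitin mtopology u z sequentially"
      using complete unfolding mcomplete_def by blast
    have "settles (H n) u" for n
      using settles_merge[of "case_nat h0 H" u "Suc n"] s by (simp add: h_def)
    then have "\<forall>\<^sub>F k in sequentially. u k \<in> A n \<longleftrightarrow> z \<in> A n" for n
      using H(2)[of n] u z unfolding controls_def by simp
    with z show ?thesis
      by blast
  qed
  ultimately show ?thesis
    using that by blast
qed

section \<open>Category quantifiers for a partial action\<close>

locale Polish_partial_action = continuous_topological_partial_action G T X m
  for G :: "('g, 'r) monoid_scheme" (structure) and T :: "'g topology"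
    and X :: "'x topology" and m :: "'g \<Rightarrow> 'x \<Rightarrow> 'x option" +
  assumes Polish_T: "Polish_topology T"
    and Polish_X: "Polish_topology X"
    and gdelta_domain: "gdelta_in (prod_topology T X) (action_domain m)"
begin

definition dom_at :: "'x \<Rightarrow> 'g set" where
  "dom_at x = {g. m g x \<noteq> None}"

abbreviation fiber_top :: "'x \<Rightarrow> 'g topology" where
  "fiber_top x \<equiv> subtopology T (dom_at x)"

definition hits :: "'g set \<Rightarrow> 'x set \<Rightarrow> 'x \<Rightarrow> 'g set" where
  "hits U A x = {g \<in> U. \<exists>y\<in>A. m g x = Some y}"

text \<open>The Vaught transform \<open>A\<^sup>\<Delta>\<^sup>U\<close>, with category taken in the domain of the orbit map.\<close>

definition transform :: "'g set \<Rightarrow> 'x set \<Rightarrow> 'x set" where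
  "transform U A = {x \<in> topspace X. \<not> meager_in (fiber_top x) (hits U A x)}"

section \<open>Fibers of the action domain and orbit maps\<close>

lemma dom_at_subset: "dom_at x \<subseteq> carrier G"
  using typing by (auto simp: dom_at_def)

lemma topspace_fiber_top [simp]: "topspace (fiber_top x) = dom_at x"
  using dom_at_subset topspace_eq_carrier by auto

lemma continuous_map_section:
  "x \<in> topspace X \<Longrightarrow> continuous_map T (prod_topology T X) (\<lambda>g. (g, x))"
  by (simp add: continuous_map_pairedI)

text \<open>The fiber is the section at \<open>x\<close> of the G-delta set
  \<open>action_domain m\<close>, hence a G-delta in a completely metrizable space. This makes the
  Baire category theorem available in every fiber.\<close>

lemma completely_metrizable_fiber_top:
  assumes "x \<in> topspace X"
  shows "completely_metrizable_space (fiber_top x)"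
proof -
  have "{g \<in> topspace T. (g, x) \<in> action_domain m} = dom_at x"
    using dom_at_subset topspace_eq_carrier by (auto simp: action_domain_def dom_at_def)
  then have "gdelta_in T (dom_at x)"
    using gdelta_in_continuous_map_preimage[OF continuous_map_section[OF assms] gdelta_domain]
    by simp
  then show ?thesis
    using Polish_T completely_metrizable_space_gdelta_in by (auto simp: Polish_topology_def)
qed

lemma continuous_map_orbit:
  assumes "x \<in> topspace X"
  shows "continuous_map (fiber_top x) X (\<lambda>g. the (m g x))"
proof -
  have "continuous_map (fiber_top x) (subtopology (prod_topology T X) (action_domain m)) (\<lambda>g. (g, x))"
    using continuous_map_section[OF assms]
    by (auto simp: continuous_map_in_subtopology continuous_map_from_subtopology
        action_domain_def dom_at_def)
  from continuous_map_compose[OF this continuous_action] show ?thesis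
    by (simp add: o_def)
qed

lemma openin_hits:
  assumes "x \<in> topspace X" "openin T U" "openin X A"
  shows "openin (fiber_top x) (hits U A x)"
proof -
  have "openin (fiber_top x) (U \<inter> dom_at x)"
    using assms(2) openin_subtopology by blast
  moreover have "openin (fiber_top x) {g \<in> topspace (fiber_top x). the (m g x) \<in> A}"
    using openin_continuous_map_preimage[OF continuous_map_orbit[OF assms(1)] assms(3)] .
  ultimately have "openin (fiber_top x)
      ((U \<inter> dom_at x) \<inter> {g \<in> topspace (fiber_top x). the (m g x) \<in> A})"
    by (rule openin_Int)
  also have "(U \<inter> dom_at x) \<inter> {g \<in> topspace (fiber_top x). the (m g x) \<in> A} = hits U A x"
    unfolding topspace_fiber_top by (auto simp: hits_def dom_at_def)
  finally show ?thesis .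
qed

lemma hits_UN: "hits U (\<Union>i\<in>I. A i) x = (\<Union>i\<in>I. hits U (A i) x)"
  by (auto simp: hits_def)

lemma hits_topspace: "hits U (topspace X) x = U \<inter> dom_at x"
  using typing by (auto simp: hits_def dom_at_def)

lemma hits_diff: "hits U (topspace X - A) x = U \<inter> dom_at x - hits (carrier G) A x"
  using typing by (auto simp: hits_def dom_at_def)

lemma openin_action_preimage:
  assumes g: "g \<in> carrier G" and A: "openin X A"
  shows "openin X {x. \<exists>y\<in>A. m g x = Some y}"
proof -
  let ?D = "pa_range G m (inv g)"
  have D: "?D = dom (m g)" "openin X ?D"
    using g open_range[of "inv g"] by (simp_all add: pa_range_def)
  have "continuous_map (subtopology X ?D) X (\<lambda>x. the (m g x))"
    using homeomorphic_imp_continuous_map[OF homeo[OF g]] continuous_map_in_subtopology by blast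
  from openin_continuous_map_preimage[OF this A]
  have "openin X {x \<in> topspace (subtopology X ?D). the (m g x) \<in> A}"
    using D(2) openin_trans_full by blast
  also have "{x \<in> topspace (subtopology X ?D). the (m g x) \<in> A} = {x. \<exists>y\<in>A. m g x = Some y}"
    using D(1) typing by auto
  finally show ?thesis .
qed

text \<open>Orbit maps are continuous, so open sets pull back to open sets; the Baire property then
  survives complements and countable unions.\<close>

lemma Baire_property_hits:
  assumes x: "x \<in> topspace X" and A: "A \<in> sets (Borel_algebra X)"
  shows "Baire_property (fiber_top x) (hits (carrier G) A x)"
proof -
  have "A \<in> sigma_sets (topspace X) {U. openin X U}"
    using A by (simp add: sets_Borel_algebra)
  then show ?thesis
  proof induction
    case (Basic U)
    then show ?case
      using x openin_hits[of x "carrier G" U] topspace_eq_carrier Baire_property_openin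
      by (metis mem_Collect_eq openin_topspace)
  next
    case Empty
    show ?case
      using Baire_property_openin[of _ "{}"] by (simp add: hits_def)
  next
    case (Compl A)
    then show ?case
      using Baire_property_complement[OF Compl.IH] dom_at_subset[of x]
      unfolding topspace_fiber_top hits_diff by (simp only: inf.absorb2)
  next
    case (Union A)
    then show ?case
      by (simp add: hits_UN Baire_property_UN)
  qed
qed

text \<open>For open \<open>U\<close> and \<open>A\<close> the hitting set is open in a Baire space,
  hence nonmeager as soon as it is nonempty.\<close>

lemma transform_openin:
  assumes "openin T U" "openin X A"
  shows "transform U A = (\<Union>g\<in>U. {x. \<exists>y\<in>A. m g x = Some y})"
proof -
  have "\<not> meager_in (fiber_top x) (hits U A x) \<longleftrightarrow> hits U A x \<noteq> {}" if "x \<in> topspace X" for x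
    using not_meager_in_openin[OF completely_metrizable_fiber_top openin_hits] that assms
      meager_in_empty by metis
  then have "x \<in> transform U A \<longleftrightarrow> x \<in> topspace X \<and> (\<exists>g\<in>U. \<exists>y\<in>A. m g x = Some y)" for x
    unfolding transform_def hits_def by blast
  then show ?thesis
    using typing by blast
qed

text \<open>Induction on \<open>A\<close> for all open \<open>U\<close> at once, because the
  complement case needs the transforms of \<open>A\<close> over all basic open subsets of
  \<open>U\<close>.\<close>

lemma transform_in_Borel:
  assumes A: "A \<in> sets (Borel_algebra X)" and U: "openin T U"
  shows "transform U A \<in> sets (Borel_algebra X)"
proof -
  obtain \<B> where base: "countable \<B>" "\<forall>V\<in>\<B>. openin T V"
      "\<forall>U g. openin T U \<and> g \<in> U \<longrightarrow> (\<exists>V\<in>\<B>. g \<in> V \<and> V \<subseteq> U)"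
    by (rule Polish_topology_countable_base[OF Polish_T])
  note \<B> = base(1) base(2)[rule_format] base(3)[rule_format, OF conjI]
  have open_case: "transform U A \<in> sets (Borel_algebra X)" if "openin T U" "openin X A" for U A
    unfolding transform_openin[OF that]
    using openin_action_preimage that openin_subset[OF that(1)] topspace_eq_carrier
    by (intro openin_imp_Borel openin_Union) auto
  have "A \<in> sigma_sets (topspace X) {U. openin X U}"
    using A by (simp add: sets_Borel_algebra)
  then show ?thesis
    using U
  proof (induction arbitrary: U)
    case (Basic A)
    then show ?case
      using open_case by simp
  next
    case Empty
    show ?case
      by (simp add: transform_def hits_def)
  next
    case (Compl A)
    have AB: "A \<in> sets (Borel_algebra X)"
      using Compl.hyps by (simp add: sets_Borel_algebra)
    \<comment> \<open>The complement of \<open>A\<close> is hit nonmeagerly in \<open>U\<close> iff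
      \<open>A\<close> is hit only meagerly in some basic \<open>V\<close> that meets the fiber. The
      factor \<open>transform V (topspace X)\<close> expresses that \<open>V\<close> meets
      \<open>dom_at x\<close>, which may fail for a partial action.\<close>
    have "x \<in> transform U (topspace X - A) \<longleftrightarrow>
        (\<exists>V\<in>{V \<in> \<B>. V \<subseteq> U}. x \<in> transform V (topspace X) - transform V A)"
      (is "?L \<longleftrightarrow> ?R") if x: "x \<in> topspace X" for x
    proof -
      let ?H = "hits (carrier G) A x"
      note cm = completely_metrizable_fiber_top[OF x]
      have oU: "openin (fiber_top x) (V \<inter> dom_at x)" if "openin T V" for V
        using that openin_subtopology by blast
      have hit: "hits V A x = V \<inter> dom_at x \<inter> ?H" if "openin T V" for V
        using openin_subset[OF that] topspace_eq_carrier by (auto simp: hits_def dom_at_def)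
      have "?L \<longleftrightarrow> \<not> meager_in (fiber_top x) (U \<inter> dom_at x - ?H)"
        using x by (simp add: transform_def hits_diff)
      also have "\<dots> \<longleftrightarrow> (\<exists>W. openin (fiber_top x) W \<and> W \<noteq> {} \<and> W \<subseteq> U \<inter> dom_at x \<and>
          meager_in (fiber_top x) (W \<inter> ?H))"
        by (rule not_meager_in_diff_iff[OF cm Baire_property_hits[OF x AB] oU[OF Compl.prems]])
      also have "\<dots> \<longleftrightarrow> ?R"
      proof
        assume "\<exists>W. openin (fiber_top x) W \<and> W \<noteq> {} \<and> W \<subseteq> U \<inter> dom_at x \<and>
          meager_in (fiber_top x) (W \<inter> ?H)"
        then obtain W g where W: "openin (fiber_top x) W" "g \<in> W" "W \<subseteq> U \<inter> dom_at x"
            "meager_in (fiber_top x) (W \<inter> ?H)"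
          by blast
        then obtain W' where W': "openin T W'" "W = W' \<inter> dom_at x"
          unfolding openin_subtopology by blast
        \<comment> \<open>The relatively open \<open>W\<close> is shrunk to the trace of a basic
          neighbourhood of one of its points, of which there are only countably many.\<close>
        obtain V where V: "V \<in> \<B>" "g \<in> V" "V \<subseteq> U \<inter> W'"
          using \<B>(3)[of "U \<inter> W'" g] W W' Compl.prems by blast
        have "meager_in (fiber_top x) (hits V A x)"
          using W(4) by (rule meager_in_subset) (use hit[OF \<B>(2)[OF V(1)]] V W' in blast)
        moreover have "\<not> meager_in (fiber_top x) (V \<inter> dom_at x)"
          using not_meager_in_openin[OF cm oU[OF \<B>(2)[OF V(1)]]] V(2) W by blast
        ultimately show ?R
          using V x by (auto simp: transform_def hits_topspace)
      next
        assume ?R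
        then obtain V where V: "V \<in> \<B>" "V \<subseteq> U" "\<not> meager_in (fiber_top x) (V \<inter> dom_at x)"
            "meager_in (fiber_top x) (hits V A x)"
          using x by (auto simp: transform_def hits_topspace)
        then have "V \<inter> dom_at x \<noteq> {}"
          using meager_in_empty by metis
        with V oU[OF \<B>(2)[OF V(1)]] hit[OF \<B>(2)[OF V(1)]]
        show "\<exists>W. openin (fiber_top x) W \<and> W \<noteq> {} \<and> W \<subseteq> U \<inter> dom_at x \<and>
          meager_in (fiber_top x) (W \<inter> ?H)"
          by (intro exI[of _ "V \<inter> dom_at x"]) auto
      qed
      finally show ?thesis .
    qed
    then have "transform U (topspace X - A) =
        (\<Union>V\<in>{V \<in> \<B>. V \<subseteq> U}. transform V (topspace X) - transform V A)"
      by (auto simp: transform_def)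
    moreover have "\<dots> \<in> sets (Borel_algebra X)"
      using \<B>(1,2) Compl.IH open_case by (intro sets.countable_UN'' sets.Diff) auto
    ultimately show ?case
      by simp
  next
    case (Union A)
    \<comment> \<open>A countable union is meager iff all its members are, so the transform commutes
      with countable unions.\<close>
    have "transform U (\<Union>i. A i) = (\<Union>i. transform U (A i))"
    proof -
      have "meager_in (fiber_top x) (hits U (\<Union>i. A i) x) \<longleftrightarrow>
          (\<forall>i. meager_in (fiber_top x) (hits U (A i) x))" for x
        using meager_in_UN[of UNIV "fiber_top x" "\<lambda>i. hits U (A i) x"]
          meager_in_subset[of "fiber_top x" "\<Union>i. hits U (A i) x"]
        unfolding hits_UN by blast
      then show ?thesis
        by (auto simp: transform_def)
    qed
    then show ?case
      using Union by auto
  qed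
qed

text \<open>The identity lies in every fiber, so fibers are nonempty. This starts the induction
  along \<open>branch\<close>.\<close>

lemma transform_carrier_topspace: "transform (carrier G) (topspace X) = topspace X"
proof -
  have "openin T (carrier G)"
    using topspace_eq_carrier by (metis openin_topspace)
  then show ?thesis
    using transform_openin[of "carrier G" "topspace X"] PA3 typing by fastforce
qed

text \<open>Category pigeonhole: a nonmeager set is not a countable union of meager ones. It
  supplies the next digit of a branch.\<close>

lemma transform_UN_eq:
  assumes "countable I" "x \<in> transform U (\<Union>i\<in>I. A i)"
  obtains i where "i \<in> I" "x \<in> transform U (A i)"
proof -
  have "\<not> (\<forall>i\<in>I. meager_in (fiber_top x) (hits U (A i) x))"
    using assms(2) meager_in_UN[OF assms(1), of "fiber_top x" "\<lambda>i. hits U (A i) x"]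
    by (auto simp: transform_def hits_UN)
  then show ?thesis
    using that assms(2) by (auto simp: transform_def)
qed

lemma transform_nonempty:
  assumes "x \<in> transform U A"
  obtains g y where "g \<in> U" "y \<in> A" "m g x = Some y"
proof -
  have "hits U A x \<noteq> {}"
    using assms meager_in_empty unfolding transform_def by (metis (lifting) mem_Collect_eq)
  then show ?thesis
    using that by (auto simp: hits_def)
qed

text \<open>Right translation by \<open>h\<^sup>-\<^sup>1\<close> identifies the fibers over \<open>x\<close> and \<open>h \<cdot> x\<close>.\<close>

lemma transform_invariant:
  assumes h: "m h x = Some y"
  shows "x \<in> transform (carrier G) A \<longleftrightarrow> y \<in> transform (carrier G) A"
proof -
  have *: "meager_in (fiber_top y) (hits (carrier G) A y)"
    if h: "m h x = Some y" and mg: "meager_in (fiber_top x) (hits (carrier G) A x)" for x y h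
  proof -
    have hG: "h \<in> carrier G" and h': "m (inv h) y = Some x"
      using typing PA1 h by blast+
    have cont: "continuous_map T T (\<lambda>g. g \<otimes> k)" if "k \<in> carrier G" for k
    proof -
      have "continuous_map T (prod_topology T T) (\<lambda>g. (g, k))"
        using that topspace_eq_carrier by (simp add: continuous_map_pairedI)
      from continuous_map_compose[OF this continuous_mult] show ?thesis
        by (simp add: o_def)
    qed
    \<comment> \<open>By \<open>PA2\<close>, right translation by \<open>inv h\<close> carries the
      fiber over \<open>x\<close> into the fiber over \<open>y\<close> and preserves the value of
      the orbit map; \<open>to_x\<close> is the same for the inverse translation.\<close>
    have to_y: "m (g \<otimes> inv h) y = m g x" if "m g x \<noteq> None" for g
      using that PA2[OF h'] by auto
    have to_x: "m (g \<otimes> h) x = m g y" if "m g y \<noteq> None" for g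
      using that PA2[OF h] by auto
    have "g \<otimes> inv h \<otimes> h = g" "g \<otimes> h \<otimes> inv h = g" if "g \<in> topspace T" for g
      using that hG topspace_eq_carrier by (simp_all add: m_assoc)
    then have homeo: "homeomorphic_maps (fiber_top x) (fiber_top y) (\<lambda>g. g \<otimes> inv h) (\<lambda>g. g \<otimes> h)"
      unfolding homeomorphic_maps_def continuous_map_in_subtopology
      using cont[OF hG] cont[of "inv h"] hG to_y to_x dom_at_subset
      by (auto simp: continuous_map_from_subtopology dom_at_def subset_iff)
    have "(\<lambda>g. g \<otimes> inv h) ` hits (carrier G) A x = hits (carrier G) A y"
    proof
      show "(\<lambda>g. g \<otimes> inv h) ` hits (carrier G) A x \<subseteq> hits (carrier G) A y"
        using to_y hG by (auto simp: hits_def)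
      show "hits (carrier G) A y \<subseteq> (\<lambda>g. g \<otimes> inv h) ` hits (carrier G) A x"
      proof
        fix g assume g: "g \<in> hits (carrier G) A y"
        then have "g \<otimes> h \<in> hits (carrier G) A x" "g = (g \<otimes> h) \<otimes> inv h"
          using to_x[of g] hG by (auto simp: hits_def m_assoc)
        then show "g \<in> (\<lambda>g. g \<otimes> inv h) ` hits (carrier G) A x"
          by blast
      qed
    qed
    then show ?thesis
      using meager_in_homeomorphic_image[OF homeomorphic_maps_imp_map[OF homeo] mg] by simp
  qed
  \<comment> \<open>The claim for \<open>h\<close> and for \<open>inv h\<close> gives the two
    implications.\<close>
  show ?thesis
    using *[OF h] *[OF PA1[OF h]] typing[OF h] by (auto simp: transform_def)
qed

end

section \<open>The leftmost nonmeager branch\<close>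

context Polish_partial_action
begin

definition cell :: "(nat \<Rightarrow> 'x \<Rightarrow> nat) \<Rightarrow> nat list \<Rightarrow> 'x set" where
  "cell h l = {y \<in> topspace X. \<forall>i<length l. h i y = l ! i}"

text \<open>For \<open>x\<close> in the space each \<open>LEAST\<close> is attained, by
  \<open>branch_in_transform\<close>. Only transforms over the whole group enter, so the branch
  depends on the orbit of \<open>x\<close> alone.\<close>

primrec branch :: "(nat \<Rightarrow> 'x \<Rightarrow> nat) \<Rightarrow> nat \<Rightarrow> 'x \<Rightarrow> nat list" where
  "branch h 0 x = []"
| "branch h (Suc n) x =
    branch h n x @ [LEAST c. x \<in> transform (carrier G) (cell h (branch h n x @ [c]))]"

lemma length_branch [simp]: "length (branch h n x) = n"
  by (induction n) auto

text \<open>Longer branches extend shorter ones, so digit \<open>i\<close> of the infinite branch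
  may be read off at length \<open>Suc i\<close>.\<close>

lemma branch_nth: "i < k \<Longrightarrow> branch h k x ! i = branch h (Suc i) x ! i"
  by (induction k) (auto simp: nth_append less_Suc_eq)

lemma cell_Nil [simp]: "cell h [] = topspace X"
  by (simp add: cell_def)

lemma cell_split: "cell h l = (\<Union>c. cell h (l @ [c]))"
  by (auto simp: cell_def nth_append less_Suc_eq)

text \<open>A cell is the union of its countably many children, so some child is still hit
  nonmeagerly and the least such digit exists.\<close>

lemma branch_in_transform:
  assumes "x \<in> topspace X"
  shows "x \<in> transform (carrier G) (cell h (branch h n x))"
proof (induction n)
  case 0
  show ?case
    using assms by (simp add: transform_carrier_topspace)
next
  case (Suc n)
  then obtain c where "x \<in> transform (carrier G) (cell h (branch h n x @ [c]))"
    using transform_UN_eq[of UNIV x "carrier G" "\<lambda>c. cell h (branch h n x @ [c])"]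
    by (auto simp: cell_split[symmetric])
  then show ?case
    unfolding branch.simps by (rule LeastI)
qed

lemma branch_invariant: "m g x = Some y \<Longrightarrow> branch h n x = branch h n y"
  by (induction n) (simp_all add: transform_invariant)

lemma measurable_branch:
  assumes h [measurable]: "\<And>n. h n \<in> measurable (Borel_algebra X) (count_space UNIV)"
  shows "branch h n \<in> measurable (Borel_algebra X) (count_space UNIV)"
proof (induction n)
  case 0
  show ?case
    by simp
next
  case (Suc n)
  note Suc.IH [measurable]
  have "{y \<in> space (Borel_algebra X). \<forall>i. i < length l \<longrightarrow> h i y = l ! i} \<in> sets (Borel_algebra X)" for l
    by measurable
  then have "cell h l \<in> sets (Borel_algebra X)" for l
    unfolding cell_def space_Borel_algebra .
  moreover have "openin T (carrier G)"
    using topspace_eq_carrier by (metis openin_topspace)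
  ultimately have [measurable]: "transform (carrier G) (cell h l) \<in> sets (Borel_algebra X)" for l
    using transform_in_Borel by blast
  \<comment> \<open>Since \<open>branch h n\<close> has values in a countable type, it may be frozen
    to a fixed \<open>l\<close>.\<close>
  have "(\<lambda>x. l @ [LEAST c. x \<in> transform (carrier G) (cell h (l @ [c]))])
      \<in> measurable (Borel_algebra X) (count_space UNIV)" for l
    by measurable
  from measurable_compose_countable[OF this Suc.IH] show ?case
    by simp
qed

text \<open>Nonmeager sets are nonempty, so the orbit of \<open>x\<close> meets the cell of every
  finite initial part of the branch.\<close>

lemma branch_witness:
  assumes "x \<in> topspace X"
  obtains g y where "m g x = Some y" "y \<in> topspace X" "\<And>i. i < n \<Longrightarrow> h i y = branch h (Suc i) x ! i"
proof -
  obtain g y where gy: "m g x = Some y" "y \<in> cell h (branch h n x)"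
    using transform_nonempty[OF branch_in_transform[OF assms]] by metis
  have "h i y = branch h (Suc i) x ! i" if "i < n" for i
    using gy(2) that branch_nth[OF that] by (simp add: cell_def)
  with gy show ?thesis
    using that by (auto simp: cell_def)
qed

section \<open>Reading a Borel selector off the branch\<close>

lemma Borel_selector_exists:
  assumes Y: "Polish_topology Y" and f: "Borel_map X Y f"
    and fE: "\<And>x y. x \<in> topspace X \<Longrightarrow> y \<in> topspace X \<Longrightarrow> (x, y) \<in> orbit_rel G m \<longleftrightarrow> f x = f y"
  shows "\<exists>S. Borel_selector X (orbit_rel G m) S"
proof (cases "topspace X = {}")
  case True
  then show ?thesis
    by (intro exI[of _ id]) (simp add: Borel_selector_def)
next
  case False
  obtain M d where Md: "Metric_space M d" "Metric_space.mcomplete M d" "X = Metric_space.mtopology M d"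
    using Polish_X unfolding Polish_topology_def completely_metrizable_space_def by blast
  interpret Metric_space M d
    by (fact Md(1))
  note X_eq [simp] = Md(3)
  have M: "topspace X = M"
    by simp
  obtain C where C: "countable C" "C \<subseteq> M" "mtopology closure_of C = M"
    using Polish_X by (auto simp: Polish_topology_def separable_space_def)
  have "C \<noteq> {}"
    using False C(3) by auto
  then obtain q :: "nat \<Rightarrow> 'x" where q: "range q = C"
    using C(1) by (metis range_from_nat_into)
  have qM: "q n \<in> M" for n
    using q C(2) by blast
  obtain \<V> where base: "countable \<V>" "\<forall>V\<in>\<V>. openin Y V"
      "\<forall>U y. openin Y U \<and> y \<in> U \<longrightarrow> (\<exists>V\<in>\<V>. y \<in> V \<and> V \<subseteq> U)"
    by (rule Polish_topology_countable_base[OF Y])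
  note \<V> = base(1) base(2)[rule_format] base(3)[rule_format, OF conjI]
  \<comment> \<open>Adding the empty set keeps the family nonempty, so that \<open>V\<close>
    enumerates it.\<close>
  define V where "V = from_nat_into (insert {} \<V>)"
  have rV: "range V = insert {} \<V>"
    using \<V>(1) by (simp add: V_def range_from_nat_into)
  \<comment> \<open>The code is made to control the preimages under \<open>f\<close> of a countable
    base of \<open>Y\<close>; this carries the values of \<open>f\<close> to limits although
    \<open>f\<close> is only Borel.\<close>
  define A where "A n = f -` V n \<inter> M" for n
  have "openin Y (V n)" for n
    using rV \<V>(2) by (metis insert_iff openin_empty rangeI)
  then have A: "A n \<in> sets (Borel_algebra mtopology)" for n
    using measurable_sets[OF f openin_imp_Borel] by (simp add: A_def)
  have rq: "range q \<subseteq> M" "mtopology closure_of range q = M"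
    using q C(2,3) by auto
  obtain h p where code:
      "\<forall>n. h n \<in> measurable (Borel_algebra mtopology) (count_space UNIV)"
      "\<forall>j. \<forall>x\<in>M. d (q (h (p j) x)) x < 1 / Suc j"
      "\<forall>u. range u \<subseteq> M \<and> settles h u \<longrightarrow>
      (\<exists>z. limitin mtopology u z sequentially \<and>
        (\<forall>n. \<forall>\<^sub>F k in sequentially. u k \<in> A n \<longleftrightarrow> z \<in> A n))"
    by (rule complete_Borel_code[OF Md(2) rq A])
  note h = code(1)[rule_format] and near = code(2)[rule_format]
    and lim = code(3)[rule_format, OF conjI]
  define c where "c x i = branch h (Suc i) x ! i" for x i
  \<comment> \<open>Only digits of the branch enter, so \<open>S\<close> inherits its invariance.
    The bound is \<le> because strict inequality may be lost in the limit.\<close>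
  define S where "S x = (THE z. z \<in> M \<and> (\<forall>j. d (q (c x (p j))) z \<le> 1 / Suc j))" for x
  have ex: "\<exists>z. z \<in> M \<and> (\<forall>j. d (q (c x (p j))) z \<le> 1 / Suc j) \<and> f z = f x" if x: "x \<in> M" for x
  proof -
    \<comment> \<open>Orbit points agreeing with the branch on ever longer initial parts: their
      codes converge to the branch.\<close>
    have "\<exists>y. y \<in> M \<and> (x, y) \<in> orbit_rel G m \<and> (\<forall>i<k. h i y = c x i)" for k
    proof -
      obtain g y where "m g x = Some y" "y \<in> topspace X" "\<And>i. i < k \<Longrightarrow> h i y = c x i"
        using branch_witness[of x k h] x unfolding c_def M by blast
      moreover from this have "y \<in> M" "(x, y) \<in> orbit_rel G m"
        using typing[of g x y] M by (auto simp: orbit_rel_def)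
      ultimately show ?thesis
        by blast
    qed
    then obtain u where u: "\<And>k. u k \<in> M" "\<And>k. (x, u k) \<in> orbit_rel G m"
        "\<And>k i. i < k \<Longrightarrow> h i (u k) = c x i"
      by metis
    have hu: "\<forall>\<^sub>F k in sequentially. h i (u k) = c x i" for i
      using eventually_gt_at_top[of i] by eventually_elim (rule u(3))
    then have "settles h u"
      unfolding settles_def by blast
    then obtain z where z: "limitin mtopology u z sequentially"
        "\<And>n. \<forall>\<^sub>F k in sequentially. u k \<in> A n \<longleftrightarrow> z \<in> A n"
      using lim[of u] u(1) by blast
    have zM: "z \<in> M"
      using z(1) by (simp add: limitin_metric)
    have fu: "f (u k) = f x" for k
      using fE[of x "u k"] u x M by simp
    \<comment> \<open>\<open>f\<close> is constant on the orbit, so whether \<open>f (u k)\<close>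
      lies in \<open>V n\<close> does not depend on \<open>k\<close>, and the answer passes to the
      limit \<open>z\<close>.\<close>
    have V_iff: "f x \<in> V n \<longleftrightarrow> f z \<in> V n" for n
    proof -
      have "\<forall>\<^sub>F k in sequentially. f x \<in> V n \<longleftrightarrow> f z \<in> V n"
        using z(2)[of n] by eventually_elim (use u(1) fu zM in \<open>simp add: A_def\<close>)
      then show ?thesis
        by simp
    qed
    have "f z = f x"
    proof (rule ccontr)
      assume ne: "f z \<noteq> f x"
      have "f z \<in> topspace Y" "f x \<in> topspace Y"
        using measurable_space[OF f] x zM M by auto
      moreover have "Hausdorff_space Y"
        using Y completely_metrizable_imp_metrizable_space metrizable_imp_Hausdorff_space
        unfolding Polish_topology_def by blast
      ultimately obtain U where U: "openin Y U" "f x \<in> U" "f z \<notin> U"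
        using ne unfolding Hausdorff_space_def disjnt_iff by metis
      then obtain W where "W \<in> \<V>" "f x \<in> W" "W \<subseteq> U"
        using \<V>(3) by blast
      moreover from this obtain n where "W = V n"
        using rV by blast
      ultimately show False
        using V_iff U(3) by blast
    qed
    moreover have "d (q (c x (p j))) z \<le> 1 / Suc j" for j
    proof -
      have "closedin mtopology (mcball (q (c x (p j))) (1 / Suc j))"
        by simp
      moreover have "\<forall>\<^sub>F k in sequentially. u k \<in> mcball (q (c x (p j))) (1 / Suc j)"
        using hu[of "p j"]
      proof eventually_elim
        case (elim k)
        then show ?case
          using near[OF u(1), of j k] qM u(1) by simp
      qed
      ultimately have "z \<in> mcball (q (c x (p j))) (1 / Suc j)"
        using limitin_closedin[OF z(1)] trivial_limit_sequentially by blast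
      then show ?thesis
        by simp
    qed
    ultimately show ?thesis
      using zM by blast
  qed
  \<comment> \<open>Common centres within 1/(j+1) of both points for all \<open>j\<close> force the
    points to coincide, so the description in \<open>S\<close> determines its point.\<close>
  have uniq: "z = z'"
    if "z \<in> M" "z' \<in> M" "\<And>j. d (w j) z \<le> 1 / Suc j" "\<And>j. d (w j) z' \<le> 1 / Suc j"
      "\<And>j. w j \<in> M" for z z' and w :: "nat \<Rightarrow> 'x"
  proof (rule ccontr)
    assume "z \<noteq> z'"
    then have "0 < d z z' / 2"
      using that(1,2) by simp
    then obtain j where "1 / real (Suc j) < d z z' / 2"
      using nat_approx_posE by blast
    moreover have "d z z' \<le> d (w j) z + d (w j) z'"
      using triangle[of z "w j" z'] that by (simp add: commute)
    ultimately show False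
      using that(3)[of j] that(4)[of j] by simp
  qed
  have S: "S x \<in> M" "d (q (c x (p j))) (S x) \<le> 1 / Suc j" "f (S x) = f x" if x: "x \<in> M" for x j
  proof -
    obtain z where z: "z \<in> M" "\<forall>j. d (q (c x (p j))) z \<le> 1 / Suc j" "f z = f x"
      using ex[OF x] by blast
    have "S x = z"
      unfolding S_def
    proof (rule the_equality)
      fix z' assume "z' \<in> M \<and> (\<forall>j. d (q (c x (p j))) z' \<le> 1 / Suc j)"
      then show "z' = z"
        using z(1,2) by (intro uniq[of z' z "\<lambda>j. q (c x (p j))"] qM) blast+
    qed (use z in blast)
    with z show "S x \<in> M" "d (q (c x (p j))) (S x) \<le> 1 / Suc j" "f (S x) = f x"
      by auto
  qed
  have S_inv: "S x = S y" if xy: "(x, y) \<in> orbit_rel G m" for x y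
  proof -
    obtain g where "m g x = Some y"
      using xy by (auto simp: orbit_rel_def)
    then have "c x = c y"
      unfolding c_def using branch_invariant by metis
    then show ?thesis
      by (simp add: S_def)
  qed
  have "S \<in> measurable (Borel_algebra X) (sigma (topspace X) {U. openin X U})"
  proof (rule measurable_measure_of)
    show "S \<in> space (Borel_algebra X) \<rightarrow> topspace X"
      using S(1) by auto
    fix U assume "U \<in> {U. openin X U}"
    then have U: "openin mtopology U"
      by simp
    \<comment> \<open>\<open>S x\<close> lies in \<open>U\<close> iff for some \<open>j\<close> the
      closed ball of radius 1/(j+1) about \<open>q (c x (p j))\<close> does. Each such condition
      concerns a single digit, and there are countably many of them.\<close>
    define I where "I = {(j, n). mcball (q n) (1 / Suc j) \<subseteq> U}"
    have "S -` U \<inter> space (Borel_algebra X) =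
        (\<Union>(j, n)\<in>I. (\<lambda>x. branch h (Suc (p j)) x ! p j) -` {n} \<inter> space (Borel_algebra X))"
      (is "?L = ?R")
    proof
      show "?R \<subseteq> ?L"
      proof
        fix x assume "x \<in> ?R"
        then obtain j where j: "mcball (q (c x (p j))) (1 / Suc j) \<subseteq> U" "x \<in> M"
          by (auto simp: I_def c_def)
        then have "S x \<in> mcball (q (c x (p j))) (1 / Suc j)"
          using S qM by simp
        with j show "x \<in> ?L"
          by auto
      qed
      show "?L \<subseteq> ?R"
      proof
        fix x assume "x \<in> ?L"
        then have x: "x \<in> M" "S x \<in> U"
          by auto
        then obtain r where r: "r > 0" "mball (S x) r \<subseteq> U"
          using U by (auto simp: openin_mtopology)
        then obtain j where "1 / real (Suc j) < r / 2"
          using nat_approx_posE[of "r / 2"] by auto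
        then have j: "2 / real (Suc j) < r"
          by (simp add: field_simps)
        have "mcball (q (c x (p j))) (1 / Suc j) \<subseteq> mball (S x) r"
        proof
          fix y assume y: "y \<in> mcball (q (c x (p j))) (1 / Suc j)"
          have "d (S x) y \<le> d (q (c x (p j))) (S x) + d (q (c x (p j))) y"
            using triangle[of "S x" "q (c x (p j))" y] S(1)[OF x(1)] qM y by (simp add: commute)
          also have "\<dots> \<le> 1 / Suc j + 1 / Suc j"
            using S(2)[OF x(1), of j] y by (intro add_mono) auto
          finally show "y \<in> mball (S x) r"
            using j y S(1)[OF x(1)] by simp
        qed
        with r(2) have "(j, c x (p j)) \<in> I"
          by (auto simp: I_def)
        then show "x \<in> ?R"
          using x(1) by (force simp: c_def)
      qed
    qed
    moreover have "(\<lambda>x. branch h (Suc i) x ! i) \<in> measurable (Borel_algebra X) (count_space UNIV)" for i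
    proof -
      have "h n \<in> measurable (Borel_algebra X) (count_space UNIV)" for n
        using h[of n] Md(3) by simp
      then have "branch h (Suc i) \<in> measurable (Borel_algebra X) (count_space UNIV)"
        by (rule measurable_branch)
      then show ?thesis
        by (rule measurable_compose) (rule measurable_count_space)
    qed
    then have "(\<lambda>x. branch h (Suc (p (fst e))) x ! p (fst e)) -` {snd e} \<inter> space (Borel_algebra X)
        \<in> sets (Borel_algebra X)" for e
      by (rule measurable_sets) simp
    then have "?R \<in> sets (Borel_algebra X)"
      unfolding split_beta by (intro sets.countable_UN'') auto
    ultimately show "S -` U \<inter> space (Borel_algebra X) \<in> sets (Borel_algebra X)"
      by (simp only:)
  qed (use openin_subset in blast)
  then have "Borel_map X X S"
    by (simp only: Borel_algebra_def)
  \<comment> \<open>Invariance gives one direction; the other holds since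
    \<open>f (S x) = f x\<close> and \<open>f\<close> separates orbits.\<close>
  moreover have "(x, y) \<in> orbit_rel G m \<longleftrightarrow> S x = S y"
    if "x \<in> topspace X" "y \<in> topspace X" for x y
    using that S_inv S(3) fE M by metis
  moreover have "(S x, x) \<in> orbit_rel G m" if "x \<in> topspace X" for x
    using that S fE M by metis
  ultimately show ?thesis
    unfolding Borel_selector_def by blast
qed

end

theorem theorem3p5:
  fixes G :: "('g, 'r) monoid_scheme" and T :: "'g topology"
    and X :: "'x topology" and m :: "'g \<Rightarrow> 'x \<Rightarrow> 'x option"
  assumes "Polish_group G T"
    and "Polish_topology X"
    and "continuous_topological_partial_action G T X m"
    and "gdelta_in (prod_topology T X) (action_domain m)"
    and "smooth_rel TYPE('y) X (orbit_rel G m)"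
  shows "\<exists>S. Borel_selector X (orbit_rel G m) S"
proof -
  interpret Polish_partial_action G T X m
    using assms Polish_group.Polish
    by (auto simp: Polish_partial_action_def Polish_partial_action_axioms_def)
  show ?thesis
    using assms(5) Borel_selector_exists unfolding smooth_rel_def by blast
qed

end
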